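(* Let $\alpha_1,\dots,\alpha_p>0$, $\beta_1,\dots,\beta_q>0$, $B_1,\dots,B_q\ge0$ and $n\in\mathbb{N}$. For $m\in\mathbb{N}$ and $z>0$ put $${}_p\Psi_q^{m}\Big[\begin{matrix}(\alpha_p,0)\\ (\beta_q,B_q)\end{matrix}\Big|z\Big]=\sum_{k=m+1}^\infty\frac{\prod_{j=1}^p\Gamma(\alpha_j)\,z^k}{k!\prod_{j=1}^q\Gamma(\beta_j+kB_j)}.$$ Then for all $z\in(0,\infty)$ $$\left({}_p\Psi_q^{n+1}\Big[\begin{matrix}(\alpha_p,0)\\ (\beta_q,B_q)\end{matrix}\Big|z\Big]\right)^2-{}_p\Psi_q^{n}\Big[\begin{matrix}(\alpha_p,0)\\ (\beta_q,B_q)\end{matrix}\Big|z\Big]\;{}_p\Psi_q^{n+2}\Big[\begin{matrix}(\alpha_p,0)\\ (\beta_q,B_q)\end{matrix}\Big|z\Big]\ge0.$$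
   Context: The Fox-Wright function is ${}_p\Psi_q\Big[\begin{matrix}(\alpha_p,A_p)\\ (\beta_q,B_q)\end{matrix}\Big|z\Big]=\sum_{k=0}^\infty\frac{\prod_{j=1}^p\Gamma(\alpha_j+kA_j)}{\prod_{j=1}^q\Gamma(\beta_j+kB_j)}\frac{z^k}{k!}$, where $(\alpha_p,A_p)$ abbreviates the list $(\alpha_1,A_1),\dots,(\alpha_p,A_p)$ and $(\beta_q,B_q)$ abbreviates $(\beta_1,B_1),\dots,(\beta_q,B_q)$. The function ${}_p\Psi_q^{n}$ is obtained from ${}_p\Psi_q$ by removing the terms with $k=0,1,\dots,n$ from the series; the notation $(\alpha_p,0)$ means that $A_1=\dots=A_p=0$. $\mathbb{N}=\{1,2,3,\dots\}$. *)

theory Defs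
  imports "HOL-Analysis.Analysis"
begin

text \<open>
  The parameter lists \<open>(\<alpha>\<^sub>1, A\<^sub>1), \<dots>, (\<alpha>\<^sub>p, A\<^sub>p)\<close> and \<open>(\<beta>\<^sub>1, B\<^sub>1), \<dots>, (\<beta>\<^sub>q, B\<^sub>q)\<close>
  of the Fox-Wright function are given as functions on the index sets \<open>{1..p}\<close> and \<open>{1..q}\<close>;
  values outside these sets are irrelevant.
\<close>

definition fox_wright_term ::
  "nat \<Rightarrow> (nat \<Rightarrow> 'a::Gamma) \<Rightarrow> (nat \<Rightarrow> 'a) \<Rightarrow> nat \<Rightarrow> (nat \<Rightarrow> 'a) \<Rightarrow> (nat \<Rightarrow> 'a) \<Rightarrow> 'a \<Rightarrow> nat \<Rightarrow> 'a"
where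
  "fox_wright_term p \<alpha> A q \<beta> B z k =
     (\<Prod>j=1..p. Gamma (\<alpha> j + of_nat k * A j)) / (\<Prod>j=1..q. Gamma (\<beta> j + of_nat k * B j))
       * (z ^ k / fact k)"

text \<open>
  The Fox-Wright series with the terms \<open>k = 0, \<dots>, n\<close> removed; the summation index is shifted
  so that the first remaining term is \<open>k = n + 1\<close>.
\<close>

definition fox_wright_tail ::
  "nat \<Rightarrow> nat \<Rightarrow> (nat \<Rightarrow> 'a::Gamma) \<Rightarrow> (nat \<Rightarrow> 'a) \<Rightarrow> nat \<Rightarrow> (nat \<Rightarrow> 'a) \<Rightarrow> (nat \<Rightarrow> 'a) \<Rightarrow> 'a \<Rightarrow> 'a"
where
  "fox_wright_tail n p \<alpha> A q \<beta> B z = (\<Sum>k. fox_wright_term p \<alpha> A q \<beta> B z (k + (n + 1)))"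

lemma fox_wright_tail_upper_zero:
  "fox_wright_tail n p \<alpha> (\<lambda>_. 0) q \<beta> B z =
     (\<Sum>k. (\<Prod>j=1..p. Gamma (\<alpha> j)) * z ^ (k + (n + 1)) /
            (fact (k + (n + 1)) * (\<Prod>j=1..q. Gamma (\<beta> j + of_nat (k + (n + 1)) * B j))))"
  by (simp add: fox_wright_tail_def fox_wright_term_def mult.commute)

end

theory Submission
  imports Defs
begin

text \<open>
  The \<open>k\<close>-th term of the series is \<open>a\<^sub>k = C g\<^sub>k z\<^sup>k / k!\<close>, where \<open>C\<close> is a product of Gamma values
  and \<open>g\<^sub>k\<close> is the reciprocal of a product of factors \<open>\<Gamma>(\<beta>\<^sub>j + k B\<^sub>j)\<close>. Since \<open>\<Gamma>\<close> is log-convex,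
  \<open>g\<close> is a log-concave sequence, and so are \<open>1/k!\<close> and \<open>z\<^sup>k\<close>; hence \<open>a\<close> is positive and log-concave
  (lemma \<open>log_concave_seq_fox_wright_term\<close>).

  The theorem is then an instance of the fact that the tails \<open>T\<^sub>n = \<Sum>\<^sub>k\<^sub>\<ge>\<^sub>n a\<^sub>k\<close> of a summable
  log-concave sequence are again log-concave (lemma \<open>log_concave_seq_tail\<close>). Indeed, from
  \<open>T\<^sub>n = a\<^sub>n + T\<^sub>n\<^sub>+\<^sub>1\<close> one obtains
  \<open>T\<^sub>n\<^sub>+\<^sub>1\<^sup>2 - T\<^sub>n T\<^sub>n\<^sub>+\<^sub>2 = a\<^sub>n\<^sub>+\<^sub>1 T\<^sub>n - a\<^sub>n T\<^sub>n\<^sub>+\<^sub>1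
    = \<Sum>\<^sub>k\<^sub>\<ge>\<^sub>0 (a\<^sub>n\<^sub>+\<^sub>1 a\<^sub>n\<^sub>+\<^sub>k - a\<^sub>n a\<^sub>n\<^sub>+\<^sub>k\<^sub>+\<^sub>1)\<close>,
  and every summand is nonnegative because the ratios of consecutive terms of \<open>a\<close> decrease.
  The same monotonicity gives \<open>g\<^sub>k \<le> g\<^sub>0 (g\<^sub>1/g\<^sub>0)\<^sup>k\<close>, so that the series is dominated by an
  exponential series and the tails are genuine sums.
\<close>

section \<open>Log-concave sequences\<close>

text \<open>
  Positivity is included because the inequality alone tolerates internal zeros, such as in
  \<open>1, 0, 0, 1\<close>, and then does not force the ratios of consecutive terms to decrease.
\<close>

definition log_concave_seq :: "(nat \<Rightarrow> real) \<Rightarrow> bool" where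
  "log_concave_seq f \<longleftrightarrow> (\<forall>k. 0 < f k \<and> f k * f (k + 2) \<le> (f (k + 1))\<^sup>2)"

lemma log_concave_seqD:
  assumes "log_concave_seq f"
  shows "0 < f k" "f k * f (k + 2) \<le> (f (k + 1))\<^sup>2"
  using assms by (auto simp: log_concave_seq_def)

lemma log_concave_seq_const: "0 < c \<Longrightarrow> log_concave_seq (\<lambda>_. c)"
  by (simp add: log_concave_seq_def power2_eq_square)

lemma log_concave_seq_power: "0 < z \<Longrightarrow> log_concave_seq (\<lambda>k. z ^ k)"
  by (simp add: log_concave_seq_def power2_eq_square)

lemma log_concave_seq_mult:
  assumes f: "log_concave_seq f" and g: "log_concave_seq g"
  shows "log_concave_seq (\<lambda>k. f k * g k)"
  unfolding log_concave_seq_def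
proof (intro allI conjI)
  fix k
  show "0 < f k * g k"
    using log_concave_seqD(1)[OF f] log_concave_seqD(1)[OF g] by simp
  have "(f k * f (k + 2)) * (g k * g (k + 2)) \<le> (f (k + 1))\<^sup>2 * (g (k + 1))\<^sup>2"
    using log_concave_seqD[OF f] log_concave_seqD[OF g]
    by (intro mult_mono) (auto intro!: mult_nonneg_nonneg less_imp_le)
  then show "f k * g k * (f (k + 2) * g (k + 2)) \<le> (f (k + 1) * g (k + 1))\<^sup>2"
    by (simp add: power_mult_distrib mult_ac)
qed

lemma log_concave_seq_prod:
  assumes "\<And>j. j \<in> J \<Longrightarrow> log_concave_seq (f j)"
  shows "log_concave_seq (\<lambda>k. \<Prod>j\<in>J. f j k)"
  using assms
  by (induction J rule: infinite_finite_induct)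
     (simp_all add: log_concave_seq_const log_concave_seq_mult)

lemma log_concave_seq_ratio_antimono:
  assumes f: "log_concave_seq f"
  shows "decseq (\<lambda>k. f (Suc k) / f k)"
proof (rule decseq_SucI)
  fix k
  show "f (Suc (Suc k)) / f (Suc k) \<le> f (Suc k) / f k"
    using log_concave_seqD[OF f, of k] log_concave_seqD(1)[OF f, of "Suc k"]
    by (simp add: field_simps power2_eq_square)
qed

text \<open>
  Every ratio of consecutive terms is at most the first one. Applied to the Gamma
  quotients, this reduces the convergence of the Fox-Wright series to that of \<open>exp\<close>.
\<close>

lemma log_concave_seq_geometric_bound:
  assumes f: "log_concave_seq f"
  shows "f k \<le> f 0 * (f 1 / f 0) ^ k"
proof (induction k)
  case 0
  show ?case by simp
next
  case (Suc k)
  have "f (Suc k) / f k \<le> f 1 / f 0"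
    using decseqD[OF log_concave_seq_ratio_antimono[OF f], of 0 k] by simp
  then have "f (Suc k) \<le> f k * (f 1 / f 0)"
    using log_concave_seqD(1)[OF f, of k]
    by (metis mult.commute pos_divide_le_eq)
  also have "\<dots> \<le> (f 0 * (f 1 / f 0) ^ k) * (f 1 / f 0)"
    using Suc.IH log_concave_seqD(1)[OF f] by (intro mult_right_mono) (auto intro: less_imp_le)
  finally show ?case by (simp add: mult_ac)
qed

section \<open>Tails of log-concave series\<close>

text \<open>
  Peeling off leading terms turns the quadratic expression in the tails into one that is linear in
  them, \<open>f (n + 1) * T n - f n * T (n + 1)\<close>; its sign can be checked term by term.
\<close>

theorem log_concave_seq_tail:
  assumes f: "log_concave_seq f" and summ: "summable f"
  shows "log_concave_seq (\<lambda>n. \<Sum>k. f (k + n))"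
  unfolding log_concave_seq_def
proof (intro allI conjI)
  fix n
  define T where "T m = (\<Sum>k. f (k + m))" for m
  have summ': "summable (\<lambda>k. f (k + m))" for m
    using summ by (rule summable_ignore_initial_segment)
  have split: "T m = f m + T (m + 1)" for m
    using suminf_split_head[OF summ'[of m]] by (simp add: T_def)
  show "0 < (\<Sum>k. f (k + n))"
    using log_concave_seqD(1)[OF f] by (intro suminf_pos summ')
  have ratio: "f n * f (k + (n + 1)) \<le> f (n + 1) * f (k + n)" for k
  proof -
    have "f (Suc (n + k)) / f (n + k) \<le> f (Suc n) / f n"
      using decseqD[OF log_concave_seq_ratio_antimono[OF f], of n "n + k"] by simp
    then show ?thesis
      using log_concave_seqD(1)[OF f, of n] log_concave_seqD(1)[OF f, of "n + k"]
      by (simp add: field_simps)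
  qed
  have "f n * T (n + 1) \<le> f (n + 1) * T n"
    unfolding T_def suminf_mult[OF summ', symmetric]
    by (intro suminf_le summable_mult summ' ratio)
  moreover have "(T (n + 1))\<^sup>2 - T n * T (n + 2) = f (n + 1) * T n - f n * T (n + 1)"
    using split[of n] split[of "n + 1"] by (simp add: power2_eq_square algebra_simps)
  ultimately have "T n * T (n + 2) \<le> (T (n + 1))\<^sup>2"
    by linarith
  then show "(\<Sum>k. f (k + n)) * (\<Sum>k. f (k + (n + 2))) \<le> (\<Sum>k. f (k + (n + 1)))\<^sup>2"
    by (simp only: T_def)
qed

section \<open>Log-concavity of the Fox-Wright terms\<close>

text \<open>
  This is midpoint log-convexity of \<open>\<Gamma>\<close>: along an arithmetic progression, each point is the
  midpoint of its neighbours.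
\<close>

lemma log_concave_seq_inverse_Gamma:
  fixes \<beta> B :: real
  assumes "\<beta> > 0" and "B \<ge> 0"
  shows "log_concave_seq (\<lambda>k. inverse (Gamma (\<beta> + real k * B)))"
  unfolding log_concave_seq_def
proof (intro allI conjI)
  fix k :: nat
  define x where "x m = \<beta> + real m * B" for m
  have x: "x m > 0" for m
    using assms by (simp add: x_def add_pos_nonneg)
  then have G: "Gamma (x m) > 0" for m
    by (simp add: Gamma_real_pos)
  then show "0 < inverse (Gamma (\<beta> + real k * B))"
    unfolding x_def by simp
  have mid: "(1 - 1 / 2) *\<^sub>R x k + (1 / 2) *\<^sub>R x (k + 2) = x (k + 1)"
    by (simp add: x_def field_simps)
  have "ln (Gamma (x (k + 1))) \<le> (1 - 1 / 2) * ln (Gamma (x k)) + 1 / 2 * ln (Gamma (x (k + 2)))"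
    using convex_onD[OF log_convex_Gamma_real, of "1 / 2" "x k" "x (k + 2)"] x
    unfolding mid by simp
  then have "ln ((Gamma (x (k + 1)))\<^sup>2) \<le> ln (Gamma (x k) * Gamma (x (k + 2)))"
    using G by (simp add: ln_mult_pos ln_realpow)
  then have le: "(Gamma (x (k + 1)))\<^sup>2 \<le> Gamma (x k) * Gamma (x (k + 2))"
    by (rule iffD1[OF ln_le_cancel_iff, rotated -1]) (intro zero_less_power mult_pos_pos G)+
  have "inverse (Gamma (x k) * Gamma (x (k + 2))) \<le> inverse ((Gamma (x (k + 1)))\<^sup>2)"
    by (intro le_imp_inverse_le le zero_less_power G)
  then show "inverse (Gamma (\<beta> + real k * B)) * inverse (Gamma (\<beta> + real (k + 2) * B))
      \<le> (inverse (Gamma (\<beta> + real (k + 1) * B)))\<^sup>2"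
    unfolding x_def by (simp add: power_inverse)
qed

lemma log_concave_seq_inverse_fact: "log_concave_seq (\<lambda>k. inverse (fact k))"
  using log_concave_seq_inverse_Gamma[of 1 1]
  by (simp add: Gamma_fact)

context
  fixes p q :: nat and \<alpha> \<beta> B :: "nat \<Rightarrow> real" and z :: real
  assumes \<alpha>: "\<And>j. j \<in> {1..p} \<Longrightarrow> \<alpha> j > 0"
    and \<beta>: "\<And>j. j \<in> {1..q} \<Longrightarrow> \<beta> j > 0"
    and B: "\<And>j. j \<in> {1..q} \<Longrightarrow> B j \<ge> 0"
    and z: "z > 0"
begin

lemma fox_wright_term_upper_zero:
  "fox_wright_term p \<alpha> (\<lambda>_. 0) q \<beta> B z k =
     (\<Prod>j=1..p. Gamma (\<alpha> j)) * (\<Prod>j=1..q. inverse (Gamma (\<beta> j + real k * B j)))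
       * (z ^ k * inverse (fact k))"
  by (simp add: fox_wright_term_def divide_inverse prod_inversef[unfolded comp_def])

text \<open>
  The coefficients are isolated from \<open>z ^ k / fact k\<close> because the geometric bound is applied to them
  alone, so that the factorial survives in the dominating series.
\<close>

lemma log_concave_seq_fox_wright_coeff:
  "log_concave_seq
     (\<lambda>k. (\<Prod>j=1..p. Gamma (\<alpha> j)) * (\<Prod>j=1..q. inverse (Gamma (\<beta> j + real k * B j))))"
  using \<alpha> \<beta> B
  by (intro log_concave_seq_mult log_concave_seq_const log_concave_seq_prod
        log_concave_seq_inverse_Gamma prod_pos ballI Gamma_real_pos) auto

lemma log_concave_seq_fox_wright_term:
  "log_concave_seq (fox_wright_term p \<alpha> (\<lambda>_. 0) q \<beta> B z)"
  unfolding fox_wright_term_upper_zero[abs_def]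
  by (intro log_concave_seq_mult[OF log_concave_seq_fox_wright_coeff]
        log_concave_seq_mult[OF log_concave_seq_power[OF z] log_concave_seq_inverse_fact])

lemma summable_fox_wright_term:
  "summable (fox_wright_term p \<alpha> (\<lambda>_. 0) q \<beta> B z)"
proof -
  define c where
    "c k = (\<Prod>j=1..p. Gamma (\<alpha> j)) * (\<Prod>j=1..q. inverse (Gamma (\<beta> j + real k * B j)))" for k
  have c: "log_concave_seq c"
    using log_concave_seq_fox_wright_coeff by (simp add: c_def[abs_def])
  have term_eq: "fox_wright_term p \<alpha> (\<lambda>_. 0) q \<beta> B z k = c k * (z ^ k * inverse (fact k))" for k
    by (simp add: fox_wright_term_upper_zero c_def)
  have "summable (\<lambda>k. c 0 * (inverse (fact k) * (c 1 / c 0 * z) ^ k))"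
    by (intro summable_mult summable_exp)
  then show ?thesis
  proof (rule summable_comparison_test')
    fix k :: nat
    have "norm (fox_wright_term p \<alpha> (\<lambda>_. 0) q \<beta> B z k) = c k * (z ^ k * inverse (fact k))"
      using log_concave_seqD(1)[OF c, of k] z by (simp add: term_eq abs_mult)
    also have "\<dots> \<le> (c 0 * (c 1 / c 0) ^ k) * (z ^ k * inverse (fact k))"
      using log_concave_seq_geometric_bound[OF c] z by (intro mult_right_mono) auto
    also have "\<dots> = c 0 * (inverse (fact k) * (c 1 / c 0 * z) ^ k)"
      unfolding power_mult_distrib by (simp only: mult_ac)
    finally show "norm (fox_wright_term p \<alpha> (\<lambda>_. 0) q \<beta> B z k)
        \<le> c 0 * (inverse (fact k) * (c 1 / c 0 * z) ^ k)" .
  qed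
qed

end

section \<open>The Turan-type inequality for the tails\<close>

theorem theorem4:
  fixes p q n :: nat
    and \<alpha> \<beta> B :: "nat \<Rightarrow> real"
    and z :: real
  assumes "\<And>j. j \<in> {1..p} \<Longrightarrow> \<alpha> j > 0"
    and "\<And>j. j \<in> {1..q} \<Longrightarrow> \<beta> j > 0"
    and "\<And>j. j \<in> {1..q} \<Longrightarrow> B j \<ge> 0"
    and "n \<ge> 1"
    and "z \<in> {0<..}"
  shows "(fox_wright_tail (n + 1) p \<alpha> (\<lambda>_. 0) q \<beta> B z)\<^sup>2
           - fox_wright_tail n p \<alpha> (\<lambda>_. 0) q \<beta> B z * fox_wright_tail (n + 2) p \<alpha> (\<lambda>_. 0) q \<beta> B z \<ge> 0"
proof -
  have z: "z > 0"
    using assms(5) by simp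
  have "log_concave_seq (\<lambda>m. \<Sum>k. fox_wright_term p \<alpha> (\<lambda>_. 0) q \<beta> B z (k + m))"
    using assms(1-3) z
    by (intro log_concave_seq_tail log_concave_seq_fox_wright_term summable_fox_wright_term)
  from log_concave_seqD(2)[OF this, of "n + 1"] show ?thesis
    by (simp add: fox_wright_tail_def)
qed

end
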